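(* Where $H_{a,b,c,t,(u_i)_1^m, (v_j)_1^n}$ is a tileable dented hexagon (implying $t=n+m$), \begin{align*} {\mathrm{M}(H_{a,b,c,t,\vec u, \vec v})} &= {\mathrm{M}(H_{0,b,c,t,\vec u, \vec v})} \prod_{i=1}^m(u_i)_{\underline{u_i}} \prod_{j=1}^n(v_j)_{\underline{v_j}}\\ & \times \frac{P(a,b+n, c+m)}{\prod_{i=1}^m(a+u_i)_{\underline{u_i}}\prod_{j=1}^n(a+v_j)_{\underline{v_j}}}. \end{align*}
   Context: $\mathrm{M}(R)$ denotes the number of lozenge tilings of a region $R$ of the triangular lattice. $(x)_y=\prod_{i=0}^{y-1}(x+i)$ is the Pochhammer symbol and $P(a,b,c)=\prod_{i=1}^c \frac{(a+i)_b}{(i)_b}$ (MacMahon's formula for the number of tilings of the semiregular hexagon with sides $a,b,c$). $H_{a,b,c,t}$ is the hexagon on the triangular lattice whose side lengths in clockwise order starting from the north side are $a, b+t, c, a+t, b, c+t$. Given integer vectors $\vec u=(u_i)_{i=1}^m$ with $1\le u_1<\dots<u_m\le b+t$ and $\vec v=(v_j)_{j=1}^n$ with $1\le v_1<\dots<v_n\le c+t$ (and $a>0$ or $u_1>1$ or $v_1>1$), the dented hexagon $H_{a,b,c,t,\vec u,\vec v}$ is obtained from $H_{a,b,c,t}$ by removing the $u_i$th unit triangle along the northeast side and the $v_j$th unit triangle along the northwest side, indexing from the north end of each side. Here $\underline{u_i}:=b+n+i-u_i$ and $\underline{v_j}:=c+m+j-v_j$. The formula is to be read with $H_{0,b,c,t,\vec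 u,\vec v}$ well defined. *)

theory Defs
  imports Complex_Main "HOL-Library.Disjoint_Sets"
begin

text \<open>
  The pair (i, j) of integers stands for the point i e + j f of the triangular lattice, where
  e = (1, 0) and f = (1/2, sqrt 3 / 2); so there are horizontal lattice lines, and north is the
  direction of growing j.  \<open>Up i j\<close> and \<open>Down i j\<close> are the two unit triangles, pointing up
  resp. down, into which the rhombus spanned by e and f at (i, j) is cut.
\<close>

datatype unit_triangle = Up int int | Down int int

fun vertices :: "unit_triangle \<Rightarrow> (int \<times> int) set" where
  "vertices (Up i j) = {(i, j), (i + 1, j), (i, j + 1)}"
| "vertices (Down i j) = {(i + 1, j), (i, j + 1), (i + 1, j + 1)}"

text \<open>Regions are sets of unit triangles; a lozenge is the union of two unit triangles that have
  an edge, i.e. exactly two vertices, in common.\<close>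

definition is_lozenge :: "unit_triangle set \<Rightarrow> bool" where
  "is_lozenge L \<longleftrightarrow> (\<exists>s s'. L = {s, s'} \<and> card (vertices s \<inter> vertices s') = 2)"

definition lozenge_tiling :: "unit_triangle set \<Rightarrow> unit_triangle set set \<Rightarrow> bool" where
  "lozenge_tiling R T \<longleftrightarrow> partition_on R T \<and> (\<forall>L\<in>T. is_lozenge L)"

definition tileable :: "unit_triangle set \<Rightarrow> bool" where
  "tileable R \<longleftrightarrow> (\<exists>T. lozenge_tiling R T)"

definition num_tilings :: "unit_triangle set \<Rightarrow> nat" where
  "num_tilings R = card {T. lozenge_tiling R T}"

text \<open>
  The hexagon whose sides, clockwise from the north side, have lengths
  a, b + t, c, a + t, b, c + t.  Its west end of the north side is placed at the origin, and
  its corners are then, clockwise,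
  (0, 0), (a, 0), (a + b + t, -(b + t)), (a + b + t, -(b + c + t)), (b, -(b + c + t)), (0, -(c + t)).
  The six inequalities are the half-planes of the sides N, S, NW, SE, NE, SW.
\<close>

definition hexagon_points :: "nat \<Rightarrow> nat \<Rightarrow> nat \<Rightarrow> nat \<Rightarrow> (int \<times> int) set" where
  "hexagon_points a b c t =
     {(i, j). j \<le> 0 \<and> - int (b + c + t) \<le> j \<and>
              0 \<le> i \<and> i \<le> int (a + b + t) \<and>
              i + j \<le> int a \<and> - int (c + t) \<le> i + j}"

definition hexagon :: "nat \<Rightarrow> nat \<Rightarrow> nat \<Rightarrow> nat \<Rightarrow> unit_triangle set" where
  "hexagon a b c t = {s. vertices s \<subseteq> hexagon_points a b c t}"

text \<open>
  The k-th unit triangle, counted from the north end, along the northeast side is the one having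
  the k-th segment of that side, from (a + k - 1, -(k - 1)) to (a + k, -k), as an edge; the k-th
  one along the northwest side has the edge from (0, -(k - 1)) to (0, -k).
\<close>

definition ne_triangle :: "nat \<Rightarrow> nat \<Rightarrow> unit_triangle" where
  "ne_triangle a k = Up (int a + int k - 1) (- int k)"

definition nw_triangle :: "nat \<Rightarrow> unit_triangle" where
  "nw_triangle k = Up 0 (- int k)"

text \<open>Dent vectors (u 1, ..., u m) and (v 1, ..., v n) are functions of which only the values
  at 1..m resp. 1..n matter.\<close>

definition dents :: "nat \<Rightarrow> nat \<Rightarrow> (nat \<Rightarrow> nat) \<Rightarrow> nat \<Rightarrow> (nat \<Rightarrow> nat) \<Rightarrow> unit_triangle set" where
  "dents a m u n v = (\<lambda>i. ne_triangle a (u i)) ` {1..m} \<union> (\<lambda>j. nw_triangle (v j)) ` {1..n}"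

definition dented_hexagon ::
  "nat \<Rightarrow> nat \<Rightarrow> nat \<Rightarrow> nat \<Rightarrow> nat \<Rightarrow> (nat \<Rightarrow> nat) \<Rightarrow> nat \<Rightarrow> (nat \<Rightarrow> nat) \<Rightarrow> unit_triangle set" where
  "dented_hexagon a b c t m u n v = hexagon a b c t - dents a m u n v"

text \<open>
  For a = 0 the first triangles along the northeast and the northwest side coincide, so they must
  not both be removed.  The last condition, that the triangles to be removed are there, excludes
  only dents on hexagons degenerated to a segment (a = c = t = 0 with m > 0, or a = b = t = 0
  with n > 0), which have sides of positive length but contain no unit triangle.
\<close>

definition dents_well_defined ::
  "nat \<Rightarrow> nat \<Rightarrow> nat \<Rightarrow> nat \<Rightarrow> nat \<Rightarrow> (nat \<Rightarrow> nat) \<Rightarrow> nat \<Rightarrow> (nat \<Rightarrow> nat) \<Rightarrow> bool" where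
  "dents_well_defined a b c t m u n v \<longleftrightarrow>
     strict_mono_on {1..m} u \<and> u ` {1..m} \<subseteq> {1..b + t} \<and>
     strict_mono_on {1..n} v \<and> v ` {1..n} \<subseteq> {1..c + t} \<and>
     (m = 0 \<or> n = 0 \<or> a > 0 \<or> u 1 > 1 \<or> v 1 > 1) \<and>
     dents a m u n v \<subseteq> hexagon a b c t"

definition macmahon :: "nat \<Rightarrow> nat \<Rightarrow> nat \<Rightarrow> real" where
  "macmahon a b c = (\<Prod>i=1..c. pochhammer (real (a + i)) b / pochhammer (real i) b)"

text \<open>The underlined dent positions.  The truncated subtraction is exact when t = m + n: the u i
  are strictly increasing and at most b + t, so u i \<open>\<le>\<close> b + t - (m - i) = b + n + i, and likewise
  for v.\<close>

definition u_under :: "nat \<Rightarrow> nat \<Rightarrow> (nat \<Rightarrow> nat) \<Rightarrow> nat \<Rightarrow> nat" where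
  "u_under b n u i = b + n + i - u i"

definition v_under :: "nat \<Rightarrow> nat \<Rightarrow> (nat \<Rightarrow> nat) \<Rightarrow> nat \<Rightarrow> nat" where
  "v_under c m v j = c + m + j - v j"

end

theory Submission
  imports Defs "Jordan_Normal_Form.Determinant"
begin

text \<open>
  The edges parallel to the northwest side cut a tiling into nonintersecting lattice paths: they
  start at the undented positions k of the northwest side and end at the dents w = u i of the
  northeast side or at the southeast side.  Removing the lozenges column by column from the right
  shows that the number of tilings is the determinant of the numbers of paths; each single path step
  is Pascal's rule in one row, and colliding paths give two equal rows, so that no sign-reversing
  involution is needed.

  Row operations turn the southeast ends into further dents w = b + t + 1, ..., b + t + c.  The
  entries are then (a + w - 1 choose w - k) = (a + w - 1)! / ((w - k)! (a + k - 1)!), and pulling the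
  factorials out of rows and columns leaves a determinant independent of a.  Hence the quotient of
  the counts for a and for 0 is a product of factorials.
\<close>

subsection \<open>Determinants with rows given as functions\<close>

text \<open>Rows are functions of the source position, so Pascal's rule becomes an identity between
  rows. Lists of different lengths give a non-square matrix, whose \<open>det\<close> is 0 by
  convention; this matches a region without tilings.\<close>

definition rows_det :: "(nat \<Rightarrow> real) list \<Rightarrow> nat list \<Rightarrow> real" where
  "rows_det fs ks = det (mat (length fs) (length ks) (\<lambda>(r, l). (fs ! r) (ks ! l)))"

lemma rows_det_nonsquare: "length fs \<noteq> length ks \<Longrightarrow> rows_det fs ks = 0"
  by (simp add: rows_det_def det_def)

lemma rows_det_leibniz:
  assumes "length fs = length ks"
  shows "rows_det fs ks = (\<Sum>p | p permutes {0..<length ks}.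
           signof p * (\<Prod>i = 0..<length ks. (fs ! i) (ks ! p i)))"
proof -
  have "(\<Prod>i = 0..<length ks. mat (length ks) (length ks) (\<lambda>(r, l). (fs ! r) (ks ! l)) $$ (i, p i)) =
        (\<Prod>i = 0..<length ks. (fs ! i) (ks ! p i))" if "p permutes {0..<length ks}" for p
    using permutes_in_image[OF that] by (intro prod.cong) auto
  then show ?thesis
    using assms by (simp add: rows_det_def det_def)
qed

lemma rows_det_cong:
  assumes "length fs = length gs" "\<And>i k. i < length fs \<Longrightarrow> k \<in> set ks \<Longrightarrow> (fs ! i) k = (gs ! i) k"
  shows "rows_det fs ks = rows_det gs ks"
  unfolding rows_det_def by (rule arg_cong[of _ _ det], rule eq_matI) (use assms in auto)

lemma rows_det_add:
  "rows_det (xs @ (\<lambda>k. f k + g k) # ys) ks = rows_det (xs @ f # ys) ks + rows_det (xs @ g # ys) ks"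
proof (cases "Suc (length xs + length ys) = length ks")
  case False
  then show ?thesis by (simp add: rows_det_nonsquare)
next
  case True
  \<comment> \<open>Only the factor at index \<open>length xs\<close> involves the changed row; with
    that index excluded, \<open>f\<close> merely stands in as a placeholder.\<close>
  have split: "(\<Prod>i = 0..<length ks. ((xs @ h # ys) ! i) (ks ! p i)) =
     h (ks ! p (length xs)) *
     (\<Prod>i \<in> {0..<length ks} - {length xs}. ((xs @ f # ys) ! i) (ks ! p i))" for h and p :: "nat \<Rightarrow> nat"
  proof -
    have "(\<Prod>i = 0..<length ks. ((xs @ h # ys) ! i) (ks ! p i)) =
       h (ks ! p (length xs)) *
       (\<Prod>i \<in> {0..<length ks} - {length xs}. ((xs @ h # ys) ! i) (ks ! p i))"
      using True by (subst prod.remove[of _ "length xs"]) auto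
    also have "(\<Prod>i \<in> {0..<length ks} - {length xs}. ((xs @ h # ys) ! i) (ks ! p i)) =
       (\<Prod>i \<in> {0..<length ks} - {length xs}. ((xs @ f # ys) ! i) (ks ! p i))"
      by (rule prod.cong) (auto simp: nth_append nth_Cons split: nat.splits)
    finally show ?thesis .
  qed
  have *: "length (xs @ h # ys) = length ks" for h
    using True by simp
  show ?thesis
    unfolding rows_det_leibniz[OF *] split
    by (simp add: sum.distrib[symmetric] algebra_simps)
qed

lemma rows_det_zero_row:
  assumes "\<And>k. k \<in> set ks \<Longrightarrow> f k = 0"
  shows "rows_det (xs @ f # ys) ks = 0"
proof -
  \<comment> \<open>A zero row is twice itself, so additivity gives D = D + D.\<close>
  have "rows_det (xs @ f # ys) ks = rows_det (xs @ (\<lambda>k. f k + f k) # ys) ks"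
    by (rule rows_det_cong) (use assms in \<open>auto simp: nth_append nth_Cons split: nat.splits\<close>)
  then show ?thesis unfolding rows_det_add by linarith
qed

lemma rows_det_repeated_row:
  assumes "f \<in> set xs"
  shows "rows_det (xs @ f # ys) ks = 0"
proof (cases "Suc (length xs + length ys) = length ks")
  case False
  then show ?thesis by (simp add: rows_det_nonsquare)
next
  case True
  obtain i where i: "i < length xs" "xs ! i = f"
    using assms by (auto simp: in_set_conv_nth)
  show ?thesis
    unfolding rows_det_def
    by (rule det_identical_rows[of _ "length ks" i "length xs"])
       (use i True in \<open>auto intro!: eq_vecI simp: nth_append\<close>)
qed

text \<open>The base case, paths without steps. Equal lists give the identity matrix; otherwise the
  matrix is not square or some \<open>x\<close> occurs in no column, so its row is zero.\<close>

lemma rows_det_kronecker: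
  assumes "sorted_wrt (<) xs" "sorted_wrt (<) ks"
  shows "rows_det (map (\<lambda>x k. of_bool (k = x)) xs) ks = of_bool (set xs = set ks)"
proof (cases "xs = ks")
  case True
  have "distinct ks" using assms by (simp add: strict_sorted_iff)
  then have "rows_det (map (\<lambda>x k. of_bool (k = x)) xs) ks = det (1\<^sub>m (length ks))"
    unfolding rows_det_def True
    by (intro arg_cong[of _ _ det] eq_matI) (auto simp: nth_eq_iff_index_eq)
  then show ?thesis using True by simp
next
  case False
  then have ne: "set xs \<noteq> set ks"
    using assms strict_sorted_equal by blast
  have "rows_det (map (\<lambda>x k. of_bool (k = x)) xs) ks = 0"
  proof (cases "length xs = length ks")
    case True
    then have "card (set xs) = card (set ks)"
      using assms by (simp add: strict_sorted_iff distinct_card)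
    with ne have "\<not> set xs \<subseteq> set ks"
      by (metis card_subset_eq List.finite_set)
    then obtain x where x: "x \<in> set xs" "x \<notin> set ks" by auto
    then obtain ys zs where "xs = ys @ x # zs" by (meson split_list)
    with x show ?thesis by (auto intro!: rows_det_zero_row)
  qed (simp add: rows_det_nonsquare)
  with ne show ?thesis by simp
qed

text \<open>Each Leibniz term uses every row and every column exactly once, so all terms share the
  same factor.\<close>

lemma rows_det_scale:
  "rows_det (map (\<lambda>w k. g w * c k * F w k) ws) ks =
     prod_list (map g ws) * prod_list (map c ks) * rows_det (map F ws) ks"
proof (cases "length ws = length ks")
  case False
  then show ?thesis by (simp add: rows_det_nonsquare)
next
  case True
  have *: "(\<Prod>i = 0..<length ks. (map (\<lambda>w k. g w * c k * F w k) ws ! i) (ks ! p i)) =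
     prod_list (map g ws) * prod_list (map c ks) * (\<Prod>i = 0..<length ks. (map F ws ! i) (ks ! p i))"
    if p: "p permutes {0..<length ks}" for p
  proof -
    have "(\<Prod>i = 0..<length ks. (map (\<lambda>w k. g w * c k * F w k) ws ! i) (ks ! p i)) =
      (\<Prod>i = 0..<length ks. g (ws ! i)) * (\<Prod>i = 0..<length ks. c (ks ! p i)) *
      (\<Prod>i = 0..<length ks. (map F ws ! i) (ks ! p i))"
      unfolding prod.distrib[symmetric] by (rule prod.cong) (use True in auto)
    also have "(\<Prod>i = 0..<length ks. c (ks ! p i)) = (\<Prod>i = 0..<length ks. c (ks ! i))"
      by (rule prod.permute[OF p, of "\<lambda>i. c (ks ! i)", unfolded o_def, symmetric])
    finally show ?thesis
      using True by (simp add: prod.list_conv_set_nth)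
  qed
  show ?thesis
    using True
    by (simp add: rows_det_leibniz sum_distrib_left mult.left_commute del: nth_map)
       (rule sum.cong, simp_all add: * mult.left_commute del: nth_map)
qed

text \<open>The number of lattice paths from position \<open>k\<close> to position \<open>p\<close>
  in \<open>i\<close> steps, each keeping the position or increasing it by 1. The case
  \<open>p < k\<close> is separate because the truncated \<open>p - k\<close> would give 1.\<close>

definition binom_row :: "nat \<Rightarrow> nat \<Rightarrow> nat \<Rightarrow> real" where
  "binom_row i p k = (if k \<le> p then real (i choose (p - k)) else 0)"

lemma binom_row_Suc:
  "binom_row (Suc i) (Suc p) = (\<lambda>k. binom_row i (Suc p) k + binom_row i p k)"
proof
  fix k
  show "binom_row (Suc i) (Suc p) k = binom_row i (Suc p) k + binom_row i p k"
    by (cases "k \<le> p") (auto simp: binom_row_def Suc_diff_le not_le le_Suc_eq)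
qed

text \<open>By Pascal's rule the raised row is \<open>binom_row i (Suc p)\<close> plus the row
  directly above it; the second summand yields two equal rows.\<close>

lemma rows_det_raise_row:
  "rows_det (xs @ binom_row i p # binom_row (Suc i) (Suc p) # ys) ks =
   rows_det (xs @ binom_row i p # binom_row i (Suc p) # ys) ks"
  using rows_det_add[of "xs @ [binom_row i p]" "binom_row i (Suc p)" "binom_row i p" ys ks]
    rows_det_repeated_row[of "binom_row i p" "xs @ [binom_row i p]" ys ks]
  by (simp add: binom_row_Suc)

text \<open>The rows are raised from the last one upwards, so that the row above is still at level
  \<open>i\<close>; \<open>ys\<close> collects the rows already raised.\<close>

lemma rows_det_raise_tail:
  "rows_det (xs @ map (\<lambda>s. binom_row i (p + s)) [0..<Suc n] @ ys) ks =
   rows_det (xs @ binom_row i p # map (\<lambda>s. binom_row (Suc i) (p + s)) [1..<Suc n] @ ys) ks"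
proof (induction n arbitrary: ys)
  case (Suc n)
  have "rows_det (xs @ map (\<lambda>s. binom_row i (p + s)) [0..<Suc (Suc n)] @ ys) ks =
    rows_det ((xs @ map (\<lambda>s. binom_row i (p + s)) [0..<n]) @
      binom_row i (p + n) # binom_row i (Suc (p + n)) # ys) ks"
    by simp
  also have "\<dots> = rows_det (xs @ map (\<lambda>s. binom_row i (p + s)) [0..<Suc n] @
      binom_row (Suc i) (Suc (p + n)) # ys) ks"
    by (subst rows_det_raise_row[symmetric]) simp
  also have "\<dots> = rows_det (xs @ binom_row i p # map (\<lambda>s. binom_row (Suc i) (p + s)) [1..<Suc (Suc n)] @ ys) ks"
    by (subst Suc) simp
  finally show ?case .
qed simp

text \<open>Raising ever shorter tails lifts row \<open>s\<close> exactly \<open>s\<close> times.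
  Level minus position becomes constant, as it is for the northeast dents.\<close>

lemma rows_det_staircase:
  "rows_det (xs @ map (\<lambda>s. binom_row i (p + s)) [0..<n]) ks =
   rows_det (xs @ map (\<lambda>s. binom_row (i + s) (p + s)) [0..<n]) ks"
proof (induction n arbitrary: xs i p)
  case (Suc n)
  have shift: "[1..<Suc n] = map Suc [0..<n]" by (simp add: map_Suc_upt)
  have "rows_det (xs @ map (\<lambda>s. binom_row i (p + s)) [0..<Suc n]) ks =
    rows_det (xs @ binom_row i p # map (\<lambda>s. binom_row (Suc i) (p + s)) [1..<Suc n]) ks"
    using rows_det_raise_tail[of xs i p n "[]" ks] by simp
  also have "\<dots> = rows_det ((xs @ [binom_row i p]) @ map (\<lambda>s. binom_row (Suc i) (Suc p + s)) [0..<n]) ks"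
    unfolding shift by (simp add: o_def)
  also have "\<dots> = rows_det ((xs @ [binom_row i p]) @ map (\<lambda>s. binom_row (Suc i + s) (Suc p + s)) [0..<n]) ks"
    by (rule Suc)
  also have "(xs @ [binom_row i p]) @ map (\<lambda>s. binom_row (Suc i + s) (Suc p + s)) [0..<n] =
     xs @ map (\<lambda>s. binom_row (i + s) (p + s)) [0..<Suc n]"
    by (simp add: upt_conv_Cons shift[simplified] o_def del: upt_Suc flip: map_Suc_upt)
  finally show ?case .
qed simp

subsection \<open>Lozenges and the peeling recursion\<close>

abbreviation adjacent :: "unit_triangle \<Rightarrow> unit_triangle \<Rightarrow> bool" where
  "adjacent s s' \<equiv> card (vertices s \<inter> vertices s') = 2"

lemma adjacent_commute: "adjacent s s' \<longleftrightarrow> adjacent s' s"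
  by (simp add: Int_commute)

lemma not_adjacent_self: "\<not> adjacent s s"
  by (cases s) (auto simp: card_insert_if)

lemma adjacentE:
  assumes "adjacent s s'"
  obtains p q where "p \<noteq> q" "p \<in> vertices s" "q \<in> vertices s" "p \<in> vertices s'" "q \<in> vertices s'"
proof -
  from assms obtain p q where "vertices s \<inter> vertices s' = {p, q}" "p \<noteq> q"
    by (auto simp: card_2_iff)
  then show thesis using that[of p q] by blast
qed

lemma adjacentI:
  assumes "vertices s \<inter> vertices s' = {p, q}" "p \<noteq> q"
  shows "adjacent s s'"
  using assms by (simp add: card_2_iff)

lemma adjacent_Down_iff:
  "adjacent (Down i j) s \<longleftrightarrow> s = Up i j \<or> s = Up (i + 1) j \<or> s = Up i (j + 1)"
proof
  assume "adjacent (Down i j) s"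
  then obtain p q where *: "p \<noteq> q" "p \<in> vertices (Down i j)" "q \<in> vertices (Down i j)"
    "p \<in> vertices s" "q \<in> vertices s" by (rule adjacentE)
  show "s = Up i j \<or> s = Up (i + 1) j \<or> s = Up i (j + 1)"
  proof (cases s)
    case (Up x y)
    show ?thesis using *[unfolded Up vertices.simps insert_iff empty_iff simp_thms]
      unfolding Up by (elim disjE) simp_all
  next
    case (Down x y)
    have "s = Down i j" using *[unfolded Down vertices.simps insert_iff empty_iff simp_thms]
      unfolding Down by (elim disjE) simp_all
    with \<open>adjacent (Down i j) s\<close> not_adjacent_self show ?thesis by blast
  qed
next
  have "adjacent (Down i j) (Up i j)"
    by (rule adjacentI[of _ _ "(i + 1, j)" "(i, j + 1)"]) auto
  moreover have "adjacent (Down i j) (Up (i + 1) j)"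
    by (rule adjacentI[of _ _ "(i + 1, j)" "(i + 1, j + 1)"]) auto
  moreover have "adjacent (Down i j) (Up i (j + 1))"
    by (rule adjacentI[of _ _ "(i, j + 1)" "(i + 1, j + 1)"]) auto
  moreover assume "s = Up i j \<or> s = Up (i + 1) j \<or> s = Up i (j + 1)"
  ultimately show "adjacent (Down i j) s" by blast
qed

lemma adjacent_Up_iff:
  "adjacent (Up i j) s \<longleftrightarrow> s = Down i j \<or> s = Down (i - 1) j \<or> s = Down i (j - 1)"
proof (cases s)
  case (Up x y)
  have False if "adjacent (Up i j) (Up x y)"
  proof -
    from that obtain p q where *: "p \<noteq> q" "p \<in> vertices (Up i j)" "q \<in> vertices (Up i j)"
      "p \<in> vertices (Up x y)" "q \<in> vertices (Up x y)" by (rule adjacentE)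
    then have "Up x y = Up i j"
      unfolding vertices.simps insert_iff empty_iff simp_thms by (elim disjE) simp_all
    with that not_adjacent_self show False by metis
  qed
  with Up show ?thesis by auto
next
  case (Down x y)
  then show ?thesis using adjacent_Down_iff[of x y "Up i j"] by (auto simp: Int_commute)
qed

section \<open>Removing lozenges from tilings\<close>

lemma finite_tilings: "finite R \<Longrightarrow> finite {T. lozenge_tiling R T}"
  by (rule finite_subset[of _ "Pow (Pow R)"]) (auto simp: lozenge_tiling_def partition_on_def)

lemma num_tilings_empty: "num_tilings {} = 1"
proof -
  have "{T. lozenge_tiling {} T} = {{}}" by (auto simp: lozenge_tiling_def partition_on_def)
  then show ?thesis by (simp add: num_tilings_def)
qed

lemma lozenge_tiling_insert:
  assumes "x \<in> R" "y \<in> R" "adjacent x y"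
  shows "lozenge_tiling R T \<and> {x, y} \<in> T \<longleftrightarrow>
         (\<exists>T'. lozenge_tiling (R - {x, y}) T' \<and> T = insert {x, y} T')"
proof (intro iffI; elim conjE exE)
  assume T: "lozenge_tiling R T" "{x, y} \<in> T"
  have "lozenge_tiling (R - {x, y}) (T - {{x, y}})"
    using T unfolding lozenge_tiling_def partition_on_def disjoint_def
    by (auto 4 3)
  with T show "\<exists>T'. lozenge_tiling (R - {x, y}) T' \<and> T = insert {x, y} T'"
    by (intro exI[of _ "T - {{x, y}}"]) auto
next
  fix T' assume T': "lozenge_tiling (R - {x, y}) T'" "T = insert {x, y} T'"
  have "is_lozenge {x, y}" using assms(3) by (auto simp: is_lozenge_def)
  moreover have "partition_on R (insert {x, y} T')"
    using T'(1) assms unfolding lozenge_tiling_def partition_on_def disjoint_def by auto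
  ultimately show "lozenge_tiling R T \<and> {x, y} \<in> T"
    using T' by (auto simp: lozenge_tiling_def)
qed

text \<open>\<open>insert {x, y}\<close> is a bijection from the tilings of the smaller region; it
  is injective because none of them contains \<open>{x, y}\<close>.\<close>

lemma num_tilings_containing:
  assumes "x \<in> R" "y \<in> R" "adjacent x y"
  shows "card {T. lozenge_tiling R T \<and> {x, y} \<in> T} = num_tilings (R - {x, y})"
proof -
  have "{x, y} \<notin> T" if "lozenge_tiling (R - {x, y}) T" for T
    using that by (auto simp: lozenge_tiling_def partition_on_def)
  then have "inj_on (insert {x, y}) {T. lozenge_tiling (R - {x, y}) T}"
    by (intro inj_onI) (metis insert_ident mem_Collect_eq)
  moreover have "{T. lozenge_tiling R T \<and> {x, y} \<in> T} =
      insert {x, y} ` {T. lozenge_tiling (R - {x, y}) T}"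
    unfolding lozenge_tiling_insert[OF assms] by auto
  ultimately show ?thesis by (simp add: num_tilings_def card_image)
qed

text \<open>In a tiling \<open>x\<close> lies in exactly one lozenge, since the blocks cover the
  region and are disjoint. The tilings are classified by the partner \<open>y\<close> of
  \<open>x\<close>.\<close>

lemma num_tilings_peel:
  assumes "finite R" "x \<in> R"
  shows "num_tilings R = (\<Sum>y | y \<in> R \<and> adjacent x y. num_tilings (R - {x, y}))"
proof -
  have cover: "{T. lozenge_tiling R T} =
      (\<Union>y\<in>{y. y \<in> R \<and> adjacent x y}. {T. lozenge_tiling R T \<and> {x, y} \<in> T})"
  proof (intro Set.set_eqI iffI)
    fix T assume "T \<in> {T. lozenge_tiling R T}"
    then have T: "partition_on R T" "\<And>L. L \<in> T \<Longrightarrow> is_lozenge L"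
      by (auto simp: lozenge_tiling_def)
    from T(1) assms(2) obtain L where L: "L \<in> T" "x \<in> L"
      by (auto simp: partition_on_def)
    with T(2) obtain s s' where "L = {s, s'}" "adjacent s s'"
      unfolding is_lozenge_def by blast
    with L obtain y where y: "L = {x, y}" "adjacent x y"
      using adjacent_commute by (metis insertE insert_commute singletonD)
    then have "y \<in> R" using T(1) L by (auto simp: partition_on_def)
    with y L T show "T \<in> (\<Union>y\<in>{y. y \<in> R \<and> adjacent x y}. {T. lozenge_tiling R T \<and> {x, y} \<in> T})"
      by (auto simp: lozenge_tiling_def)
  qed auto
  have disj: "{T. lozenge_tiling R T \<and> {x, y} \<in> T} \<inter> {T. lozenge_tiling R T \<and> {x, y'} \<in> T} = {}"
    if ne: "y \<noteq> y'" for y y'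
  proof -
    have False if "partition_on R T" "{x, y} \<in> T" "{x, y'} \<in> T" for T
    proof -
      have "{x, y} = {x, y'}"
        using disjointD[OF partition_onD2[OF that(1)] that(2,3)] by blast
      with ne show False by (auto simp: doubleton_eq_iff)
    qed
    then show ?thesis by (auto simp: lozenge_tiling_def)
  qed
  have "num_tilings R = (\<Sum>y | y \<in> R \<and> adjacent x y. card {T. lozenge_tiling R T \<and> {x, y} \<in> T})"
    unfolding num_tilings_def cover
  proof (rule card_UN_disjoint)
    show "finite {y. y \<in> R \<and> adjacent x y}" using assms(1) by simp
    show "\<forall>y\<in>{y. y \<in> R \<and> adjacent x y}. finite {T. lozenge_tiling R T \<and> {x, y} \<in> T}"
      using finite_tilings[OF assms(1)] by simp
  qed (use disj in blast)
  also have "\<dots> = (\<Sum>y | y \<in> R \<and> adjacent x y. num_tilings (R - {x, y}))"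
    by (rule sum.cong[OF refl], rule num_tilings_containing[OF assms(2)]) blast+
  finally show ?thesis .
qed

lemma num_tilings_isolated:
  assumes "finite R" "x \<in> R" "\<And>y. y \<in> R \<Longrightarrow> \<not> adjacent x y"
  shows "num_tilings R = 0"
proof -
  have none: "{y. y \<in> R \<and> adjacent x y} = {}" using assms(3) by blast
  show ?thesis unfolding num_tilings_peel[OF assms(1,2)] none by (rule sum.empty)
qed

text \<open>The lozenges \<open>{x, f x}\<close> are forced one by one. Injectivity of
  \<open>f\<close> and disjointness of \<open>X\<close> from its image keep the other pairs intact
  when one is removed.\<close>

lemma num_tilings_forced:
  assumes "finite R" "finite X" "inj_on f X" "X \<subseteq> R" "f ` X \<subseteq> R" "X \<inter> f ` X = {}"
    and "\<And>x. x \<in> X \<Longrightarrow> adjacent x (f x)"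
    and "\<And>x y. x \<in> X \<Longrightarrow> y \<in> R \<Longrightarrow> adjacent x y \<Longrightarrow> y = f x"
  shows "num_tilings R = num_tilings (R - (X \<union> f ` X))"
  using assms(2,1,3-)
proof (induction X arbitrary: R rule: finite_induct)
  case (insert x X)
  have "{y. y \<in> R \<and> adjacent x y} = {f x}" using insert.prems by auto
  then have "num_tilings R = num_tilings (R - {x, f x})"
    using num_tilings_peel[of R x] insert.prems by simp
  also have "\<dots> = num_tilings (R - {x, f x} - (X \<union> f ` X))"
  proof (rule insert.IH)
    show "f ` X \<subseteq> R - {x, f x}" "inj_on f X" "X \<subseteq> R - {x, f x}" "X \<inter> f ` X = {}"
      using insert.prems(2-5) insert.hyps(2) by (auto simp: inj_on_def)
    show "adjacent y (f y)" if "y \<in> X" for y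
      using insert.prems(6) that by blast
    show "z = f y" if "y \<in> X" "z \<in> R - {x, f x}" "adjacent y z" for y z
      using insert.prems(7) that by blast
  qed (use insert.prems(1) in simp)
  also have "R - {x, f x} - (X \<union> f ` X) = R - (insert x X \<union> f ` insert x X)" by auto
  finally show ?case .
qed simp

subsection \<open>Peeling the dented hexagon by columns\<close>

text \<open>Column \<open>i\<close> is the strip between the lines \<open>i\<close> and
  \<open>Suc i\<close> parallel to the northwest side, and \<open>k\<close> counts downwards from
  the north side. For \<open>i > 0\<close>, \<open>up i k\<close> and \<open>down (i - 1) k\<close>
  share the \<open>k\<close>-th segment of line \<open>i\<close>, where a path may cross.\<close>

definition up :: "nat \<Rightarrow> nat \<Rightarrow> unit_triangle" where "up i k = Up (int i) (- int k)"
definition down :: "nat \<Rightarrow> nat \<Rightarrow> unit_triangle" where "down i k = Down (int i) (- int k)"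

fun column :: "unit_triangle \<Rightarrow> int" where
  "column (Up i j) = i"
| "column (Down i j) = i"

lemma column_simps [simp]: "column (up i k) = int i" "column (down i k) = int i"
  by (simp_all add: up_def down_def)

lemma up_down_inject [simp]:
  "up i k = up i' k' \<longleftrightarrow> i = i' \<and> k = k'" "down i k = down i' k' \<longleftrightarrow> i = i' \<and> k = k'"
  "up i k \<noteq> down i' k'" "down i' k' \<noteq> up i k"
  by (auto simp: up_def down_def)

lemma binom_row_0: "binom_row 0 = (\<lambda>p k. of_bool (k = p))"
  by (auto simp: binom_row_def fun_eq_iff binomial_eq_0)

lemma not_adjacent_ups: "\<not> adjacent (up i k) (up i' k')"
  unfolding up_def adjacent_Up_iff by simp

locale dented_hex =
  fixes a b c t m n :: nat and u v :: "nat \<Rightarrow> nat"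
  assumes well_defined: "dents_well_defined a b c t m u n v"
begin

definition region :: "unit_triangle set" where "region = dented_hexagon a b c t m u n v"

definition ups :: "nat \<Rightarrow> nat set" where "ups i = {k. up i k \<in> region}"
definition downs :: "nat \<Rightarrow> nat set" where "downs i = {k. down i k \<in> region}"

definition us :: "nat list" where "us = map u [1..<Suc m]"
text \<open>The northeast dent w lies in column a + w - 1.\<close>

definition early :: "nat \<Rightarrow> nat list" where "early i = filter (\<lambda>w. a + w \<le> i) us"
definition here :: "nat \<Rightarrow> nat list" where "here i = filter (\<lambda>w. a + w = Suc i) us"

definition sources :: "nat list" where
  "sources = filter (\<lambda>k. k \<notin> v ` {1..n}) [1..<Suc (c + t)]"

text \<open>The dent \<open>w\<close> has its left edge on line \<open>a + w - 1\<close>, so a path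
  from the northwest side reaches it after that many steps.\<close>

definition ne_row :: "nat \<Rightarrow> nat \<Rightarrow> real" where "ne_row w = binom_row (a + w - 1) w"

text \<open>One row per path end: dents of earlier columns, left edges \<open>A\<close> of column
  \<open>i\<close> after \<open>i\<close> steps, right edges \<open>B\<close> after
  \<open>Suc i\<close> steps.\<close>

definition path_rows :: "nat \<Rightarrow> nat list \<Rightarrow> nat list \<Rightarrow> (nat \<Rightarrow> real) list" where
  "path_rows i A B = map ne_row (early i) @ map (binom_row i) A @ map (binom_row (Suc i)) B"

text \<open>The columns left of i are complete; in column i, the up triangles at A are already used up
  (or are dents), and only the down triangles at B are present.  Thus A and B are the positions at
  which the paths cross the vertical edges on the left side of column i resp. on its right side.\<close>

definition stage :: "nat \<Rightarrow> nat list \<Rightarrow> nat list \<Rightarrow> unit_triangle set" where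
  "stage i A B = {s \<in> region. column s < int i} \<union> up i ` (ups i - set A) \<union> down i ` set B"

lemma set_us: "set us = u ` {1..m}"
  unfolding us_def by (simp only: set_map set_upt atLeastLessThanSuc_atLeastAtMost)

lemma set_sources: "set sources = {1..c + t} - v ` {1..n}"
  unfolding sources_def by (auto simp del: upt_Suc)

lemma sorted_us: "sorted_wrt (<) us"
proof -
  have "strict_mono_on {1..m} u" using well_defined by (simp add: dents_well_defined_def)
  then show ?thesis unfolding us_def sorted_wrt_map
    by (intro sorted_wrt_mono_rel[OF _ sorted_wrt_upt]) (auto simp: strict_mono_on_def)
qed

lemma sorted_sources: "sorted_wrt (<) sources"
  unfolding sources_def by (intro sorted_wrt_filter sorted_wrt_upt)

lemma us_bounds: "w \<in> set us \<Longrightarrow> 1 \<le> w \<and> w \<le> b + t"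
  using well_defined unfolding set_us dents_well_defined_def by auto

lemma early_Suc: "early (Suc i) = early i @ here i"
proof (rule strict_sorted_equal)
  show "sorted_wrt (<) (early (Suc i))" "sorted_wrt (<) (early i @ here i)"
    using sorted_us by (auto simp: early_def here_def sorted_wrt_append intro: sorted_wrt_filter)
  show "set (early (Suc i)) = set (early i @ here i)"
    by (auto simp: early_def here_def)
qed

lemma early_0: "early 0 = []"
  using us_bounds by (fastforce simp: early_def filter_empty_conv)

lemma early_all: "early (a + b + t) = us"
  using us_bounds by (auto simp: early_def filter_id_conv)

lemma sorted_here: "sorted_wrt (<) (here i)"
  unfolding here_def by (intro sorted_wrt_filter sorted_us)

lemma ne_row_here: "map ne_row (here i) = map (binom_row i) (here i)"
  by (auto simp: here_def ne_row_def)

section \<open>The triangles of the dented hexagon in column coordinates\<close>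

lemma hexagon_up:
  "up i k \<in> hexagon a b c t \<longleftrightarrow>
   1 \<le> k \<and> k \<le> b + c + t \<and> i + 1 \<le> a + b + t \<and> i + 1 \<le> a + k \<and> k \<le> c + t + i"
  by (auto simp: hexagon_def hexagon_points_def up_def)

lemma hexagon_down:
  "down i k \<in> hexagon a b c t \<longleftrightarrow>
   1 \<le> k \<and> k \<le> b + c + t \<and> i + 1 \<le> a + b + t \<and> i + 2 \<le> a + k \<and> k \<le> c + t + i + 1"
  by (auto simp: hexagon_def hexagon_points_def down_def)

lemma hexagonE:
  assumes "s \<in> hexagon a b c t"
  obtains i k where "s = up i k" | i k where "s = down i k"
proof (cases s)
  case (Up x y)
  with assms have "s = up (nat x) (nat (- y))"
    by (auto simp: hexagon_def hexagon_points_def up_def)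
  then show thesis by (rule that(1))
next
  case (Down x y)
  with assms have "s = down (nat x) (nat (- y))"
    by (auto simp: hexagon_def hexagon_points_def down_def)
  then show thesis by (rule that(2))
qed

lemma dents_eq: "dents a m u n v = (\<lambda>w. up (a + w - 1) w) ` set us \<union> up 0 ` v ` {1..n}"
proof -
  have "ne_triangle a (u i) = up (a + u i - 1) (u i)" if "i \<in> {1..m}" for i
    using us_bounds[of "u i"] that by (auto simp: set_us ne_triangle_def up_def of_nat_diff)
  then show ?thesis
    by (auto simp: dents_def set_us image_image nw_triangle_def up_def image_iff)
qed

lemma dents_in_hexagon: "dents a m u n v \<subseteq> hexagon a b c t"
  using well_defined by (simp add: dents_well_defined_def)

lemma up_in_region:
  "up i k \<in> region \<longleftrightarrow> up i k \<in> hexagon a b c t \<and> k \<notin> set (here i) \<and> (i = 0 \<longrightarrow> k \<notin> v ` {1..n})"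
proof -
  have "up i k \<in> dents a m u n v \<longleftrightarrow> k \<in> set (here i) \<or> i = 0 \<and> k \<in> v ` {1..n}"
    using us_bounds[of k] unfolding dents_eq here_def by (auto simp: image_iff intro!: bexI[of _ k])
  then show ?thesis by (auto simp: region_def dented_hexagon_def)
qed

lemma down_in_region: "down i k \<in> region \<longleftrightarrow> down i k \<in> hexagon a b c t"
  by (auto simp: region_def dented_hexagon_def dents_eq)

lemma regionE:
  assumes "s \<in> region"
  obtains i k where "s = up i k" "k \<in> ups i" | i k where "s = down i k" "k \<in> downs i"
  using assms hexagonE[of s] unfolding ups_def downs_def mem_Collect_eq
  by (metis DiffD1 region_def dented_hexagon_def)

lemma finite_region: "finite region"
proof (rule finite_subset)
  show "region \<subseteq> (\<lambda>(i, k). up i k) ` ({..a + b + t} \<times> {..b + c + t}) \<union>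
    (\<lambda>(i, k). down i k) ` ({..a + b + t} \<times> {..b + c + t})"
  proof
    fix s assume s: "s \<in> region"
    then show "s \<in> (\<lambda>(i, k). up i k) ` ({..a + b + t} \<times> {..b + c + t}) \<union>
      (\<lambda>(i, k). down i k) ` ({..a + b + t} \<times> {..b + c + t})"
      by (cases rule: regionE) (auto simp: ups_def downs_def up_in_region down_in_region hexagon_up hexagon_down)
  qed
qed auto

lemma here_in_hexagon: "w \<in> set (here i) \<Longrightarrow> up i w \<in> hexagon a b c t"
  using dents_in_hexagon us_bounds[of w] unfolding dents_eq here_def by force

section \<open>Tiling counts of the stages as path determinants\<close>

lemma finite_stage: "finite (stage i A B)"
proof -
  have "up i ` (ups i - set A) \<subseteq> region" by (auto simp: ups_def)
  then show ?thesis
    using finite_region by (auto simp: stage_def intro: finite_subset)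
qed

lemma in_stage [simp]:
  "up i k \<in> stage i A B \<longleftrightarrow> k \<in> ups i \<and> k \<notin> set A"
  "up (Suc i) k \<notin> stage i A B"
  "down i k \<in> stage i A B \<longleftrightarrow> k \<in> set B"
  by (auto simp: stage_def)

lemma stage_minus:
  assumes "x \<notin> set B"
  shows "stage i A (x # B) - {down i x, up i k} = stage i (A @ [k]) B"
  using assms by (auto simp: stage_def)

text \<open>A path leaving the region, traced back, misses all sources, so its row vanishes.\<close>

lemma missing_up_row:
  assumes "b0 \<in> downs i" "k = b0 \<or> Suc k = b0" "k \<notin> ups i" "k \<notin> set (here i)" "s \<in> set sources"
  shows "binom_row i k s = 0"
proof -
  have s: "1 \<le> s" "s \<le> c + t" "s \<notin> v ` {1..n}" using assms(5) by (auto simp: set_sources)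
  have d: "1 \<le> b0" "b0 \<le> b + c + t" "i + 1 \<le> a + b + t" "i + 2 \<le> a + b0"
    using assms(1) by (auto simp: downs_def down_in_region hexagon_down)
  \<comment> \<open>The up triangle lies beyond the north side, beyond the southwest side, or is a
    northwest dent; \<open>b0\<close> being present rules out the other sides.\<close>
  consider "k = 0" | "k > c + t + i" | "i = 0" "k \<in> v ` {1..n}"
    using assms(2-4) d unfolding ups_def mem_Collect_eq up_in_region hexagon_up by linarith
  then show ?thesis
  proof cases
    case 2
    then have "i < k - s" using s by linarith
    then show ?thesis by (simp add: binom_row_def binomial_eq_0)
  next
    case 3
    then show ?thesis using s by (auto simp: binom_row_0)
  qed (use s in \<open>simp add: binom_row_def\<close>)
qed

lemma adjacent_down: "adjacent (down i (Suc k)) s \<longleftrightarrow> s = up i (Suc k) \<or> s = up (Suc i) (Suc k) \<or> s = up i k"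
  unfolding up_def down_def adjacent_Down_iff by (auto simp: add.commute)

lemma adjacent_up_Suc: "adjacent (up (Suc i) k) s \<longleftrightarrow> s = down (Suc i) k \<or> s = down i k \<or> s = down (Suc i) (Suc k)"
  unfolding up_def down_def adjacent_Up_iff by (auto simp: algebra_simps)

text \<open>The down triangle at the first right edge \<open>b0\<close> pairs with the up triangle
  at \<open>b0\<close> or at \<open>b0 - 1\<close>. These are the two possible last steps of its
  path, and Pascal's rule splits its row accordingly.\<close>

lemma num_tilings_strip:
  assumes base: "\<And>A. set (here i) \<subseteq> set A \<Longrightarrow> set A \<subseteq> ups i \<union> set (here i) \<Longrightarrow> sorted_wrt (<) A \<Longrightarrow>
      real (num_tilings (stage i A [])) = rows_det (path_rows i A []) sources"
    and "set (here i) \<subseteq> set A" "set A \<subseteq> ups i \<union> set (here i)" "set B \<subseteq> downs i"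
    and "sorted_wrt (<) (A @ B)"
  shows "real (num_tilings (stage i A B)) = rows_det (path_rows i A B) sources"
  using assms(2-)
proof (induction B arbitrary: A)
  case Nil
  then show ?case using base by simp
next
  case (Cons b0 B)
  have b0: "b0 \<in> downs i" using Cons.prems by simp
  then obtain k0 where k0: "b0 = Suc k0"
    by (cases b0) (auto simp: downs_def down_in_region hexagon_down)
  have b0B: "b0 \<notin> set B" using Cons.prems by (auto simp: sorted_wrt_append)
  have branch: "rows_det (path_rows i (A @ [k]) B) sources =
      (if k \<in> ups i - set A then real (num_tilings (stage i A (b0 # B) - {down i b0, up i k})) else 0)"
    if k: "k = b0 \<or> Suc k = b0" for k
  proof (cases "k \<in> ups i - set A")
    case True
    \<comment> \<open>Sortedness gives \<open>x < b0\<close>, hence \<open>x \<le> k\<close>;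
      equality is impossible because \<open>k\<close> is not in \<open>A\<close>.\<close>
    have "x < k" if "x \<in> set A" for x
    proof -
      have "x < b0" using Cons.prems(4) that by (auto simp: sorted_wrt_append)
      moreover have "x \<noteq> k" using True that by auto
      ultimately show ?thesis using k by auto
    qed
    then have "sorted_wrt (<) ((A @ [k]) @ B)"
      using Cons.prems(4) k by (force simp: sorted_wrt_append)
    with Cons.prems True show ?thesis
      by (simp add: stage_minus[OF b0B]) (rule Cons.IH[symmetric], auto)
  next
    case False
    \<comment> \<open>Either \<open>k\<close> is already taken by a path or dent in
      \<open>A\<close>, giving two equal rows, or it is outside the region, giving a zero
      row.\<close>
    have "rows_det (path_rows i (A @ [k]) B) sources = 0"
    proof (cases "k \<in> set A")
      case True
      then show ?thesis
        using rows_det_repeated_row[of "binom_row i k" "map ne_row (early i) @ map (binom_row i) A"]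
        by (simp add: path_rows_def)
    next
      case False
      then have "k \<notin> ups i" "k \<notin> set (here i)"
        using \<open>k \<notin> ups i - set A\<close> Cons.prems(1) by auto
      then have "\<And>s. s \<in> set sources \<Longrightarrow> binom_row i k s = 0"
        using missing_up_row[OF b0 k] by blast
      then show ?thesis
        using rows_det_zero_row[of sources "binom_row i k" "map ne_row (early i) @ map (binom_row i) A"]
        by (simp add: path_rows_def)
    qed
    then show ?thesis unfolding if_not_P[OF False] .
  qed
  let ?S = "stage i A (b0 # B)"
  \<comment> \<open>The third neighbour, in column \<open>Suc i\<close>, is not in the
    stage.\<close>
  have nb: "{y. y \<in> ?S \<and> adjacent (down i b0) y} = up i ` ({b0, k0} \<inter> (ups i - set A))"
    unfolding k0 adjacent_down by auto
  have "num_tilings ?S = (\<Sum>k\<in>{b0, k0} \<inter> (ups i - set A). num_tilings (?S - {down i b0, up i k}))"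
  proof -
    have "down i b0 \<in> ?S" by simp
    then show ?thesis
      unfolding num_tilings_peel[OF finite_stage \<open>down i b0 \<in> ?S\<close>] nb
      by (subst sum.reindex) (auto simp: inj_on_def)
  qed
  then have "real (num_tilings ?S) =
      real (\<Sum>k\<in>{b0, k0} \<inter> (ups i - set A). num_tilings (?S - {down i b0, up i k}))"
    by (rule arg_cong)
  \<comment> \<open>Absent up triangles enter with weight 0, so that both summands of Pascal's rule
    appear.\<close>
  also have "\<dots> = (\<Sum>k\<in>{b0, k0}. if k \<in> ups i - set A
      then real (num_tilings (?S - {down i b0, up i k})) else 0)"
    by (simp only: sum.inter_restrict[OF finite.insertI[OF finite.insertI[OF finite.emptyI]]] of_nat_sum)
       (rule sum.cong, auto)
  also have "\<dots> = (\<Sum>k\<in>{b0, k0}. rows_det (path_rows i (A @ [k]) B) sources)"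
    by (rule sum.cong) (auto simp: branch k0)
  also have "\<dots> = rows_det (path_rows i A (b0 # B)) sources"
    using rows_det_add[of "map ne_row (early i) @ map (binom_row i) A" "binom_row i b0" "binom_row i k0"
        "map (binom_row (Suc i)) B" sources]
    by (simp add: k0 path_rows_def binom_row_Suc)
  finally show ?case .
qed

text \<open>On an interior line, \<open>down i k\<close> and \<open>up (Suc i) k\<close> share a
  segment and lie in the hexagon for the same \<open>k\<close>; right of column 0 only northeast
  dents are missing.\<close>

lemma downs_eq:
  assumes "Suc i < a + b + t"
  shows "downs i = ups (Suc i) \<union> set (here (Suc i))"
proof (intro Set.set_eqI iffI)
  fix k assume "k \<in> downs i"
  then show "k \<in> ups (Suc i) \<union> set (here (Suc i))"
    using assms by (auto simp: downs_def ups_def up_in_region down_in_region hexagon_up hexagon_down)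
next
  fix k assume "k \<in> ups (Suc i) \<union> set (here (Suc i))"
  then have "up (Suc i) k \<in> hexagon a b c t"
    using here_in_hexagon by (auto simp: ups_def up_in_region)
  then show "k \<in> downs i" by (auto simp: downs_def down_in_region hexagon_up hexagon_down)
qed

lemma full_columns:
  "{s \<in> region. column s < int (Suc i)} = {s \<in> region. column s < int i} \<union> up i ` ups i \<union> down i ` downs i"
proof (intro Set.set_eqI iffI)
  fix s assume s: "s \<in> {s \<in> region. column s < int (Suc i)}"
  then have "s \<in> region" by simp
  then show "s \<in> {s \<in> region. column s < int i} \<union> up i ` ups i \<union> down i ` downs i"
  proof (cases rule: regionE)
    case (1 j k)
    then have "j < i \<or> j = i" using s by auto
    with 1 \<open>s \<in> region\<close> show ?thesis by auto
  next
    case (2 j k)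
    then have "j < i \<or> j = i" using s by auto
    with 2 \<open>s \<in> region\<close> show ?thesis by auto
  qed
qed (auto simp: ups_def downs_def)

lemma ups_minus_here: "ups i - set (here i) = ups i"
  by (auto simp: ups_def up_in_region)

text \<open>Without down triangles in column \<open>Suc i\<close>, each remaining up triangle can
  only pair with \<open>down i k\<close> on its left. These forced lozenges leave in column
  \<open>i\<close> exactly the down triangles at \<open>A\<close>.\<close>

lemma num_tilings_next_strip:
  assumes "set (here (Suc i)) \<subseteq> set A" "set A \<subseteq> ups (Suc i) \<union> set (here (Suc i))"
    and "Suc i < a + b + t"
  shows "num_tilings (stage (Suc i) A []) = num_tilings (stage i (here i) A)"
proof -
  define X where "X = ups (Suc i) - set A"
  define f where "f s = (case s of Up x y \<Rightarrow> Down (x - 1) y | Down x y \<Rightarrow> s)" for s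
  have f_up [simp]: "f (up (Suc i) k) = down i k" for k
    by (simp add: f_def up_def down_def)
  have fX: "f ` up (Suc i) ` X = down i ` X" by (simp add: image_image)
  have Xd: "X \<subseteq> downs i" unfolding downs_eq[OF assms(3)] X_def by auto
  have dA: "downs i - X = set A"
    using assms(1,2) unfolding downs_eq[OF assms(3)] X_def
    by (auto simp: ups_def up_in_region)
  have st: "stage (Suc i) A [] = {s \<in> region. column s < int i} \<union> up i ` ups i \<union> down i ` downs i \<union> up (Suc i) ` X"
    unfolding stage_def full_columns X_def by auto
  have "num_tilings (stage (Suc i) A []) =
      num_tilings (stage (Suc i) A [] - (up (Suc i) ` X \<union> f ` up (Suc i) ` X))"
  proof (rule num_tilings_forced)
    show "finite (stage (Suc i) A [])" by (rule finite_stage)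
    show "up (Suc i) ` X \<subseteq> stage (Suc i) A []" unfolding st by auto
    then show "finite (up (Suc i) ` X)" by (rule finite_subset) (rule finite_stage)
    show "inj_on f (up (Suc i) ` X)" by (auto simp: inj_on_def)
    show "f ` up (Suc i) ` X \<subseteq> stage (Suc i) A []" unfolding st fX using Xd by auto
    show "up (Suc i) ` X \<inter> f ` up (Suc i) ` X = {}" unfolding fX by auto
    show "adjacent x (f x)" if "x \<in> up (Suc i) ` X" for x
      using that by (auto simp: adjacent_up_Suc)
    show "y = f x" if "x \<in> up (Suc i) ` X" "y \<in> stage (Suc i) A []" "adjacent x y" for x y
      using that by (auto simp: adjacent_up_Suc)
  qed
  also have "stage (Suc i) A [] - (up (Suc i) ` X \<union> f ` up (Suc i) ` X) = stage i (here i) A"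
    unfolding fX st unfolding stage_def ups_minus_here dA[symmetric] by auto
  finally show ?thesis .
qed

text \<open>A northeast dent in column 0 is itself a source: its path has no steps.\<close>

lemma sources_eq:
  assumes "0 < a + b + t"
  shows "set sources = ups 0 \<union> set (here 0)"
proof -
  \<comment> \<open>Such a dent needs \<open>a = 0\<close> and \<open>w = 1\<close>, so it is the
    triangle common to both sides, which well-definedness forbids to remove twice.\<close>
  have "w \<notin> v ` {1..n}" if w: "w \<in> set (here 0)" for w
  proof
    assume "w \<in> v ` {1..n}"
    then obtain j where j: "j \<in> {1..n}" "v j = w" by auto
    from w have "w \<in> set us" "a + w = 1" by (auto simp: here_def)
    then obtain i where i: "i \<in> {1..m}" "u i = w" by (auto simp: set_us)
    have "w = 1" "a = 0" using \<open>a + w = 1\<close> us_bounds[OF \<open>w \<in> set us\<close>] by auto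
    have "u 1 \<le> u i" "v 1 \<le> v j"
      using well_defined i j strict_mono_onD[of "{1..m}" u 1 i] strict_mono_onD[of "{1..n}" v 1 j]
      by (cases "i = 1"; cases "j = 1"; force simp: dents_well_defined_def)+
    moreover have "u 1 > 1 \<or> v 1 > 1"
      using well_defined \<open>a = 0\<close> i j by (auto simp: dents_well_defined_def)
    ultimately show False using i j \<open>w = 1\<close> by auto
  qed
  moreover have "1 \<le> w \<and> w \<le> c + t" if "w \<in> set (here 0)" for w
    using here_in_hexagon[OF that] by (auto simp: hexagon_up)
  ultimately show ?thesis
    using assms by (auto simp: set_sources ups_def up_in_region hexagon_up)
qed

text \<open>Only up triangles of column 0 are left and no two are adjacent, so a tiling exists
  exactly when none is left. This is the Kronecker determinant.\<close>

lemma num_tilings_first_strip: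
  assumes "set (here 0) \<subseteq> set A" "set A \<subseteq> ups 0 \<union> set (here 0)" "sorted_wrt (<) A" "0 < a + b + t"
  shows "real (num_tilings (stage 0 A [])) = rows_det (path_rows 0 A []) sources"
proof -
  have "\<not> column s < int 0" if "s \<in> region" for s
    using that by (cases rule: regionE) auto
  then have no_col: "{s \<in> region. column s < int 0} = {}" by blast
  have st: "stage 0 A [] = up 0 ` (ups 0 - set A)"
    unfolding stage_def no_col by simp
  have "num_tilings (stage 0 A []) = of_bool (ups 0 \<subseteq> set A)"
  proof (cases "ups 0 \<subseteq> set A")
    case True
    then have "stage 0 A [] = {}" unfolding st by auto
    with True show ?thesis by (simp add: num_tilings_empty)
  next
    case False
    then obtain k where "up 0 k \<in> stage 0 A []" unfolding st by auto
    then have "num_tilings (stage 0 A []) = 0"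
      by (rule num_tilings_isolated[OF finite_stage]) (use not_adjacent_ups in \<open>auto simp: st\<close>)
    with False show ?thesis by simp
  qed
  moreover have "ups 0 \<subseteq> set A \<longleftrightarrow> set A = set sources"
    using assms(1,2) unfolding sources_eq[OF assms(4)] by blast
  ultimately show ?thesis
    using rows_det_kronecker[OF assms(3) sorted_sources] by (simp add: path_rows_def early_0 binom_row_0)
qed

text \<open>Induction on columns: \<open>num_tilings_strip\<close> uses up the down triangles of a
  column, and \<open>num_tilings_next_strip\<close> then passes to the column on its left.\<close>

lemma num_tilings_stage:
  assumes "set (here i) \<subseteq> set A" "set A \<subseteq> ups i \<union> set (here i)" "set B \<subseteq> downs i"
    and "sorted_wrt (<) (A @ B)" "i < a + b + t"
  shows "real (num_tilings (stage i A B)) = rows_det (path_rows i A B) sources"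
  using assms
proof (induction i arbitrary: A B)
  case 0
  show ?case
    by (rule num_tilings_strip[OF num_tilings_first_strip]) (use 0 in auto)
next
  case (Suc i)
  show ?case
  proof (rule num_tilings_strip)
    fix A assume A: "set (here (Suc i)) \<subseteq> set A" "set A \<subseteq> ups (Suc i) \<union> set (here (Suc i))"
      "sorted_wrt (<) A"
    have Ad: "set A \<subseteq> downs i" using A downs_eq[of i] Suc.prems(5) by auto
    \<comment> \<open>In column \<open>i\<close> a dent has \<open>a + w = i + 1\<close>, whereas a
      down triangle needs \<open>a + x \<ge> i + 2\<close>.\<close>
    have "w < x" if "w \<in> set (here i)" "x \<in> set A" for w x
    proof -
      have "x \<in> downs i" using Ad that by auto
      with that show ?thesis by (auto simp: downs_def down_in_region hexagon_down here_def)
    qed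
    then have "real (num_tilings (stage i (here i) A)) = rows_det (path_rows i (here i) A) sources"
      using A Ad Suc.prems(5) by (intro Suc.IH) (auto simp: sorted_wrt_append sorted_here)
    \<comment> \<open>The rows of \<open>here i\<close> are dent rows and join
      \<open>early (Suc i)\<close>, so both stages have the same list of rows.\<close>
    then show "real (num_tilings (stage (Suc i) A [])) = rows_det (path_rows (Suc i) A []) sources"
      using num_tilings_next_strip[OF A(1,2) Suc.prems(5)]
      by (simp add: path_rows_def early_Suc ne_row_here)
  qed (use Suc.prems in auto)
qed

lemma num_tilings_eq_det:
  "real (num_tilings region) =
     rows_det (map ne_row us @ map (\<lambda>s. binom_row (a + b + t) (b + t + 1 + s)) [0..<c]) sources"
proof (cases "a + b + t")
  \<comment> \<open>The region is empty and has one tiling; the paths have no steps and the matrix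
    is the identity.\<close>
  case 0
 have "s \<notin> hexagon a b c t" for s
  proof
    assume "s \<in> hexagon a b c t"
    then show False
    proof (cases rule: hexagonE)
      case (1 i k)
      then have "i + 1 \<le> a + b + t" using \<open>s \<in> hexagon a b c t\<close> by (simp add: hexagon_up)
      with 0 show False by simp
    next
      case (2 i k)
      then have "i + 1 \<le> a + b + t" using \<open>s \<in> hexagon a b c t\<close> by (simp add: hexagon_down)
      with 0 show False by simp
    qed
  qed
  then have "hexagon a b c t = {}" by blast
  then have "region = {}" "m = 0" "n = 0"
    using dents_in_hexagon by (auto simp: region_def dented_hexagon_def dents_def)
  moreover have "us = []" "sources = [1..<Suc c]"
    unfolding us_def sources_def using 0 \<open>m = 0\<close> \<open>n = 0\<close> by simp_all
  moreover have "[1..<Suc c] = map Suc [0..<c]" by (simp add: map_Suc_upt)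
  ultimately show ?thesis
    using 0 rows_det_kronecker[OF sorted_sources sorted_sources]
    by (simp add: num_tilings_empty binom_row_0 o_def)
next
  case (Suc i)
  \<comment> \<open>The positions of the southeast side on line \<open>a + b + t\<close>.\<close>
  define S where "S = map (\<lambda>s. b + t + 1 + s) [0..<c]"
  have set_S: "set S = {b + t + 1..b + t + c}"
    unfolding S_def set_map set_upt image_add_atLeastLessThan by auto
  have downs: "downs i = set S"
    using Suc unfolding set_S by (auto simp: downs_def down_in_region hexagon_down)
  have "region = {s \<in> region. column s < int (Suc i)}"
  proof -
    have "column s < int (Suc i)" if "s \<in> region" for s
      using that
      by (cases rule: regionE)
         (use Suc in \<open>auto simp: ups_def downs_def up_in_region down_in_region hexagon_up hexagon_down\<close>)
    then show ?thesis by auto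
  qed
  \<comment> \<open>The whole region is the stage of its last column with all down triangles present
    and only the dents missing.\<close>
  also have "\<dots> = stage i (here i) S"
    unfolding full_columns stage_def ups_minus_here downs ..
  finally have "real (num_tilings region) = real (num_tilings (stage i (here i) S))" by simp
  also have "\<dots> = rows_det (path_rows i (here i) S) sources"
  proof (rule num_tilings_stage)
    have "sorted_wrt (<) S" unfolding S_def sorted_wrt_map
      by (rule sorted_wrt_mono_rel[OF _ sorted_wrt_upt]) auto
    moreover have "w < x" if "w \<in> set (here i)" "x \<in> set S" for w x
      using that us_bounds[of w] by (auto simp: set_S here_def)
    ultimately show "sorted_wrt (<) (here i @ S)"
      by (auto simp: sorted_wrt_append sorted_here)
  qed (use Suc downs in auto)
  also have "path_rows i (here i) S = map ne_row (early (Suc i)) @ map (binom_row (Suc i)) S"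
    by (simp add: path_rows_def early_Suc ne_row_here)
  finally show ?thesis
    using early_all unfolding Suc by (simp add: S_def o_def)
qed

end

subsection \<open>Dependence on the north side\<close>

text \<open>For \<open>x \<ge> 1\<close> this is \<open>pochhammer (real x) a\<close>, the ratio of
  (a + x - 1)! to its value at a = 0.\<close>

definition rising :: "nat \<Rightarrow> nat \<Rightarrow> real" where
  "rising a x = fact (a + x - 1) / fact (x - 1)"

lemma prod_list_map_mult:
  "(\<Prod>x\<leftarrow>xs. f x * g x) = (\<Prod>x\<leftarrow>xs. f x) * (\<Prod>x\<leftarrow>xs. g x :: real)"
  by (induction xs) simp_all

lemma rising_pos: "rising a x > 0"
  by (simp add: rising_def)

lemma pochhammer_Suc_fact: "pochhammer (real (Suc y)) r * fact y = fact (y + r)"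
proof (induction r)
  case (Suc r)
  have "pochhammer (real (Suc y)) (Suc r) * fact y =
      (pochhammer (real (Suc y)) r * fact y) * real (Suc (y + r))"
    by (simp add: pochhammer_Suc)
  then show ?case unfolding Suc by simp
qed simp

text \<open>Both sides are (a + x + r - 1)! (x - 1)! / ((a + x - 1)! (x + r - 1)!).\<close>

lemma pochhammer_quotient:
  assumes "1 \<le> x" "y = x + r"
  shows "pochhammer (real (a + x)) r / pochhammer (real x) r = rising a y / rising a x"
proof -
  obtain z where x: "x = Suc z" using assms(1) by (cases x) auto
  have p: "pochhammer (real (Suc y)) r = fact (y + r) / fact y" for y
    using pochhammer_Suc_fact[of y r] by (simp add: field_simps del: of_nat_Suc)
  show ?thesis
    unfolding assms(2) x rising_def add_Suc_right p by (simp add: ac_simps)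
qed

lemma strict_mono_on_gap:
  fixes u :: "nat \<Rightarrow> nat"
  assumes "strict_mono_on {1..m} u" "1 \<le> i" "i \<le> j" "j \<le> m"
  shows "u i + (j - i) \<le> u j"
  using assms(3,4)
proof (induction j rule: dec_induct)
  case (step j)
  have "u j < u (Suc j)" using step assms by (intro strict_mono_onD[OF assms(1)]) auto
  with step show ?case by simp
qed simp

text \<open>The \<open>m - i\<close> later values are distinct and at most \<open>N\<close>, which
  pushes \<open>u i\<close> down by as much.\<close>

lemma strict_mono_on_bound:
  fixes u :: "nat \<Rightarrow> nat"
  assumes "strict_mono_on {1..m} u" "u ` {1..m} \<subseteq> {1..N}" "i \<in> {1..m}"
  shows "1 \<le> u i \<and> u i + m \<le> N + i"
proof -
  have "u i \<in> {1..N}" "u m \<in> {1..N}"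
    using subsetD[OF assms(2) imageI] assms(3) by (simp_all del: image_subset_iff)
  moreover have "u i + (m - i) \<le> u m"
    using assms(1,3) by (intro strict_mono_on_gap) auto
  ultimately show ?thesis using assms(3) by auto
qed

lemma macmahon_eq: "macmahon a b c = (\<Prod>i = 1..c. rising a (b + i)) / (\<Prod>i = 1..c. rising a i)"
  unfolding macmahon_def prod_dividef[symmetric]
  by (rule prod.cong[OF refl], rule pochhammer_quotient) simp_all

context dented_hex
begin

section \<open>Row and column factors of the path determinant\<close>

definition targets :: "nat list" where
  "targets = us @ map (\<lambda>s. b + t + 1 + s) [0..<c]"

lemma targets_pos: "w \<in> set targets \<Longrightarrow> 1 \<le> w"
  using us_bounds by (auto simp: targets_def)

lemma num_tilings_factor:
  "real (num_tilings region) =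
     (\<Prod>w\<leftarrow>targets. fact (a + w - 1)) * (\<Prod>k\<leftarrow>sources. 1 / fact (a + k - 1)) *
     rows_det (map (\<lambda>w k. if k \<le> w then 1 / fact (w - k) else 0) targets) sources"
proof -
  \<comment> \<open>The staircase puts the southeast end \<open>w = b + t + 1 + s\<close> at level
    \<open>a + b + t + s = a + w - 1\<close>, the level of a northeast dent.\<close>
  have "real (num_tilings region) = rows_det (map ne_row targets) sources"
    unfolding num_tilings_eq_det rows_det_staircase targets_def
    by (simp add: ne_row_def o_def ac_simps)
  also have "\<dots> = rows_det (map (\<lambda>w k. fact (a + w - 1) * (1 / fact (a + k - 1)) *
      (if k \<le> w then 1 / fact (w - k) else 0)) targets) sources"
  proof (rule rows_det_cong)
    fix i k assume i: "i < length (map ne_row targets)" and "k \<in> set sources"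
    then have k: "1 \<le> k" by (auto simp: set_sources)
    define w where "w = targets ! i"
    have "1 \<le> w" using targets_pos[of w] i by (simp add: w_def)
    \<comment> \<open>As \<open>k \<ge> 1\<close>, the lower index \<open>w - k\<close> is at most
      \<open>a + w - 1\<close>, and the complementary factorial is that of
      \<open>a + k - 1\<close>.\<close>
    then have "ne_row w k = fact (a + w - 1) * (1 / fact (a + k - 1)) *
      (if k \<le> w then 1 / fact (w - k) else 0)"
      using k by (auto simp: ne_row_def binom_row_def binomial_fact)
    then show "(map ne_row targets ! i) k = (map (\<lambda>w k. fact (a + w - 1) * (1 / fact (a + k - 1)) *
      (if k \<le> w then 1 / fact (w - k) else 0)) targets ! i) k"
      using i by (simp add: w_def)
  qed simp
  also have "\<dots> = (\<Prod>w\<leftarrow>targets. fact (a + w - 1)) * (\<Prod>k\<leftarrow>sources. 1 / fact (a + k - 1)) *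
     rows_det (map (\<lambda>w k. if k \<le> w then 1 / fact (w - k) else 0) targets) sources"
    by (rule rows_det_scale)
  finally show ?thesis .
qed

lemma inj_v: "inj_on v {1..n}"
  using well_defined by (auto simp: dents_well_defined_def intro: strict_mono_on_imp_inj_on)

lemma v_in: "v ` {1..n} \<subseteq> {1..c + t}"
  using well_defined by (auto simp: dents_well_defined_def)

text \<open>A nonzero count forces the path determinant to be square: there are as many ends,
  \<open>m + c\<close>, as starts, \<open>c + t - n\<close>.\<close>

lemma tileable_balanced:
  assumes "tileable region"
  shows "t = n + m"
proof -
  have "num_tilings region \<noteq> 0"
    using assms finite_tilings[OF finite_region] by (auto simp: num_tilings_def tileable_def)
  then have "length targets = length sources"
    using num_tilings_factor by (auto intro: ccontr simp: rows_det_nonsquare)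
  moreover have "length targets = m + c"
    by (simp add: targets_def us_def del: upt_Suc)
  moreover have "length sources = card (set sources)"
    using sorted_sources by (simp add: strict_sorted_iff distinct_card)
  moreover have "card (set sources) = c + t - n"
    unfolding set_sources using v_in inj_v by (simp add: card_Diff_subset card_image)
  moreover have "n \<le> c + t"
    using card_mono[OF _ v_in] inj_v by (simp add: card_image)
  ultimately show ?thesis by linarith
qed

lemma prod_targets:
  "(\<Prod>w\<leftarrow>targets. g w) = (\<Prod>i = 1..m. g (u i)) * (\<Prod>s = 0..<c. g (b + t + 1 + s :: nat) :: real)"
  unfolding targets_def us_def
  by (simp add: prod.distinct_set_conv_list[symmetric] o_def atLeastLessThanSuc_atLeastAtMost del: upt_Suc)

lemma prod_sources:
  assumes "\<And>x. g x \<noteq> (0 :: real)"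
  shows "(\<Prod>k\<leftarrow>sources. g k) = (\<Prod>k = 1..c + t. g k) / (\<Prod>j = 1..n. g (v j))"
proof -
  have "(\<Prod>k\<leftarrow>sources. g k) = prod g (set sources)"
    using sorted_sources by (simp add: prod.distinct_set_conv_list strict_sorted_iff)
  also have "\<dots> = prod g {1..c + t} / prod g (v ` {1..n})"
    unfolding set_sources by (rule prod_diff) (use assms v_in in auto)
  also have "prod g (v ` {1..n}) = (\<Prod>j = 1..n. g (v j))"
    by (rule prod.reindex[OF inj_v, unfolded o_def])
  finally show ?thesis .
qed

lemma u_bound: "i \<in> {1..m} \<Longrightarrow> 1 \<le> u i \<and> u i + m \<le> b + t + i"
  using well_defined by (intro strict_mono_on_bound) (simp_all add: dents_well_defined_def)

lemma v_bound: "j \<in> {1..n} \<Longrightarrow> 1 \<le> v j \<and> v j + n \<le> c + t + j"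
  using well_defined by (intro strict_mono_on_bound) (simp_all add: dents_well_defined_def)

end

text \<open>The targets, the sources and the remaining determinant do not involve \<open>a\<close>.
  Hence each row contributes \<open>rising a w\<close> and each column the inverse of
  \<open>rising a k\<close>.\<close>

lemma num_tilings_ratio:
  assumes "dents_well_defined a b c t m u n v" "dents_well_defined 0 b c t m u n v"
  shows "real (num_tilings (dented_hexagon a b c t m u n v)) =
    real (num_tilings (dented_hexagon 0 b c t m u n v)) *
    ((\<Prod>i = 1..m. rising a (u i)) * (\<Prod>s = 0..<c. rising a (b + t + 1 + s))) *
    (\<Prod>j = 1..n. rising a (v j)) / (\<Prod>k = 1..c + t. rising a k)"
proof -
  interpret A: dented_hex a b c t m n u v by unfold_locales (rule assms)
  interpret Z: dented_hex 0 b c t m n u v by unfold_locales (rule assms)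
  have "(\<Prod>w\<leftarrow>A.targets. fact (a + w - 1) :: real) =
      (\<Prod>w\<leftarrow>A.targets. fact (0 + w - 1)) * (\<Prod>w\<leftarrow>A.targets. rising a w)"
    by (simp add: prod_list_map_mult[symmetric] rising_def) 
  moreover have "(\<Prod>k\<leftarrow>A.sources. 1 / fact (a + k - 1) :: real) =
      (\<Prod>k\<leftarrow>A.sources. 1 / fact (0 + k - 1)) * (\<Prod>k\<leftarrow>A.sources. inverse (rising a k))"
    by (simp add: prod_list_map_mult[symmetric] rising_def)
  ultimately have "real (num_tilings A.region) = real (num_tilings Z.region) *
    (\<Prod>w\<leftarrow>A.targets. rising a w) * (\<Prod>k\<leftarrow>A.sources. inverse (rising a k))"
    unfolding A.num_tilings_factor Z.num_tilings_factor by (simp only: mult_ac)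
  \<comment> \<open>The sources are the northwest side without its dents, so the dents move to the
    numerator.\<close>
  moreover have "(\<Prod>k\<leftarrow>A.sources. inverse (rising a k)) =
      (\<Prod>j = 1..n. rising a (v j)) / (\<Prod>k = 1..c + t. rising a k)"
  proof -
    have nonzero: "inverse (rising a x) \<noteq> 0" for x using rising_pos[of a x] by simp
    show ?thesis
      unfolding A.prod_sources[of "\<lambda>x. inverse (rising a x)", OF nonzero] prod_inversef[unfolded o_def]
      by (simp add: divide_inverse)
  qed
  ultimately show ?thesis
    by (simp add: A.region_def Z.region_def A.prod_targets)
qed

section \<open>Matching the rising factorials with MacMahon's product\<close>

theorem theorem6:
  fixes a b c t m n :: nat and u v :: "nat \<Rightarrow> nat"
  assumes "dents_well_defined a b c t m u n v"
    and "dents_well_defined 0 b c t m u n v"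
    and "tileable (dented_hexagon a b c t m u n v)"
  shows "t = n + m \<and>
    real (num_tilings (dented_hexagon a b c t m u n v)) =
      real (num_tilings (dented_hexagon 0 b c t m u n v))
      * (\<Prod>i=1..m. pochhammer (real (u i)) (u_under b n u i))
      * (\<Prod>j=1..n. pochhammer (real (v j)) (v_under c m v j))
      * (macmahon a (b + n) (c + m)
         / ((\<Prod>i=1..m. pochhammer (real (a + u i)) (u_under b n u i))
            * (\<Prod>j=1..n. pochhammer (real (a + v j)) (v_under c m v j))))"
proof -
  interpret dented_hex a b c t m n u v by unfold_locales (rule assms)
  have t: "t = n + m" using assms(3) by (intro tileable_balanced) (simp add: region_def)
  \<comment> \<open>Since \<open>u i + u_under b n u i = b + n + i\<close>, each factor is an
    inverted \<open>pochhammer_quotient\<close>.\<close>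
  have quot_u: "(\<Prod>i=1..m. pochhammer (real (u i)) (u_under b n u i)) /
      (\<Prod>i=1..m. pochhammer (real (a + u i)) (u_under b n u i)) =
      (\<Prod>i=1..m. rising a (u i)) / (\<Prod>i=1..m. rising a (b + n + i))"
    unfolding prod_dividef[symmetric]
  proof (rule prod.cong[OF refl])
    fix i assume "i \<in> {1..m}"
    from u_bound[OF this] have "1 \<le> u i" "b + n + i = u i + u_under b n u i"
      by (simp_all add: u_under_def t)
    from pochhammer_quotient[OF this, of a, THEN arg_cong[of _ _ inverse]]
    show "pochhammer (real (u i)) (u_under b n u i) / pochhammer (real (a + u i)) (u_under b n u i) =
      rising a (u i) / rising a (b + n + i)" by simp
  qed
  have quot_v: "(\<Prod>j=1..n. pochhammer (real (v j)) (v_under c m v j)) /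
      (\<Prod>j=1..n. pochhammer (real (a + v j)) (v_under c m v j)) =
      (\<Prod>j=1..n. rising a (v j)) / (\<Prod>j=1..n. rising a (c + m + j))"
    unfolding prod_dividef[symmetric]
  proof (rule prod.cong[OF refl])
    fix j assume "j \<in> {1..n}"
    from v_bound[OF this] have "1 \<le> v j" "c + m + j = v j + v_under c m v j"
      by (simp_all add: v_under_def t)
    from pochhammer_quotient[OF this, of a, THEN arg_cong[of _ _ inverse]]
    show "pochhammer (real (v j)) (v_under c m v j) / pochhammer (real (a + v j)) (v_under c m v j) =
      rising a (v j) / rising a (c + m + j)" by simp
  qed
  \<comment> \<open>The last \<open>c\<close> factors of MacMahon's numerator belong to the
    southeast ends: \<open>i = m + 1 + s\<close> turns \<open>b + n + i\<close> into
    \<open>b + t + 1 + s\<close>.\<close>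
  have split_num: "(\<Prod>i = 1..c + m. rising a (b + n + i)) =
      (\<Prod>i = 1..m. rising a (b + n + i)) * (\<Prod>s = 0..<c. rising a (b + t + 1 + s))"
  proof -
    have "(\<Prod>i = 1..m + c. rising a (b + n + i)) =
      (\<Prod>i = 1..m. rising a (b + n + i)) * (\<Prod>i = m + 1..m + c. rising a (b + n + i))"
      by (rule prod.ub_add_nat) simp
    also have "(\<Prod>i = m + 1..m + c. rising a (b + n + i)) = (\<Prod>s = 0..<c. rising a (b + t + 1 + s))"
      by (rule prod.reindex_bij_witness[of _ "\<lambda>s. m + 1 + s" "\<lambda>i. i - (m + 1)"]) (auto simp: t ac_simps)
    finally show ?thesis by (simp add: add.commute)
  qed
  \<comment> \<open>The product over the whole northwest side is MacMahon's denominator times the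
    denominator of \<open>quot_v\<close>.\<close>
  have split_den: "(\<Prod>k = 1..c + t. rising a k) =
      (\<Prod>i = 1..c + m. rising a i) * (\<Prod>j = 1..n. rising a (c + m + j))"
  proof -
    have "(\<Prod>k = 1..c + m + n. rising a k) =
      (\<Prod>k = 1..c + m. rising a k) * (\<Prod>k = c + m + 1..c + m + n. rising a k)"
      by (rule prod.ub_add_nat) simp
    also have "(\<Prod>k = c + m + 1..c + m + n. rising a k) = (\<Prod>j = 1..n. rising a (c + m + j))"
      by (rule prod.reindex_bij_witness[of _ "\<lambda>j. c + m + j" "\<lambda>k. k - (c + m)"]) auto
    finally show ?thesis by (simp add: t ac_simps)
  qed
  have nonzero: "(\<Prod>i = 1..m. rising a (b + n + i)) \<noteq> 0"
    using rising_pos[of a] by (simp add: less_imp_neq[symmetric])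
  have "real (num_tilings (dented_hexagon 0 b c t m u n v))
      * (\<Prod>i=1..m. pochhammer (real (u i)) (u_under b n u i))
      * (\<Prod>j=1..n. pochhammer (real (v j)) (v_under c m v j))
      * (macmahon a (b + n) (c + m)
         / ((\<Prod>i=1..m. pochhammer (real (a + u i)) (u_under b n u i))
            * (\<Prod>j=1..n. pochhammer (real (a + v j)) (v_under c m v j)))) =
    real (num_tilings (dented_hexagon 0 b c t m u n v))
      * ((\<Prod>i=1..m. rising a (u i)) / (\<Prod>i=1..m. rising a (b + n + i)))
      * ((\<Prod>j=1..n. rising a (v j)) / (\<Prod>j=1..n. rising a (c + m + j)))
      * macmahon a (b + n) (c + m)"
    unfolding quot_u[symmetric] quot_v[symmetric] by simp
  \<comment> \<open>The denominator of \<open>quot_u\<close> cancels the first product of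
    \<open>split_num\<close>; that of \<open>quot_v\<close> completes MacMahon's denominator to the
    one in \<open>num_tilings_ratio\<close>.\<close>
  also have "\<dots> = real (num_tilings (dented_hexagon a b c t m u n v))"
    unfolding num_tilings_ratio[OF assms(1,2)] macmahon_eq split_num split_den
    using nonzero by (simp add: ac_simps)
  finally show ?thesis using t by simp
qed

end
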